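(* Let $(S,d_S)$ be a complete separable metric space (with its Borel $\sigma$-algebra) of finite diameter, let $d\ge 1$ and $\Omega=S^{\mathbb{Z}^d}$, and assume that the set of bounded quasi-local functions on $\Omega$ is measure separating. Let $C>0$ and let $\mu$ be a translation-invariant probability measure on $\Omega$ that satisfies the Gaussian concentration bound $\mathrm{GCB}(C)$. Then for every translation-invariant probability measure $\mu'$ on $\Omega$ with $\mu'\neq\mu$ one has $$s_*(\mu'|\mu)>0 .$$
   Context: $\Omega=S^{\mathbb{Z}^d}$ carries the product topology and the product $\sigma$-algebra $\mathfrak{B}$; all probability measures on $\Omega$ are defined on $\mathfrak{B}$. For $i\in\mathbb{Z}^d$ and $\sigma\in\Omega$ put $(\tau_i\sigma)_j=\sigma_{j-i}$ for all $j\in\mathbb{Z}^d$. A probability measure $\mu$ on $\Omega$ is translation invariant if $\mu(\tau_iB)=\mu(B)$ for all $B\in\mathfrak{B}$, $i\in\mathbb{Z}^d$. For continuous $f:\Omega\to\mathbb{R}$ and $i\in\mathbb{Z}^d$, the local oscillation is $\delta_if=\sup\{f(\sigma)-f(\eta):\sigma,\eta\in\Omega,\ \sigma_j=\eta_j\ \forall j\neq i\}\in[0,\infty]$, and $\|\delta f\|_2^2=\sum_{i\in\mathbb{Z}^d}(\delta_if)^2$. A continuous function $f$ is local if $\delta_if\neq0$ for only finitely many $i$; a continuous function is quasi-local if it is a uniform limit of local functions. Measure separating means: for any two distinct probability measures $\mu,\mu'$ on $\Omega$ there is a bounded quasi-local $f$ with $\int f\,d\mu\neq\int f\,d\mu'$.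 $\mu$ satisfies $\mathrm{GCB}(C)$ if for all bounded local functions $f$, $\int e^{f-\int f\,d\mu}\,d\mu\le e^{\frac{C}{2}\|\delta f\|_2^2}$. For finite $\Lambda\subset\mathbb{Z}^d$, $\mu_\Lambda$ denotes the restriction of $\mu$ to the $\sigma$-algebra $\mathfrak{B}_\Lambda$ generated by the coordinates $\eta_i$, $i\in\Lambda$. The relative entropy is $s_\Lambda(\mu'|\mu)=\int d\mu'_\Lambda\,\log\frac{d\mu'_\Lambda}{d\mu_\Lambda}$ if $\mu'_\Lambda\ll\mu_\Lambda$, and $+\infty$ otherwise. With $\Lambda_n=[-n,n]^d\cap\mathbb{Z}^d$, the lower relative entropy density is $s_*(\mu'|\mu)=\liminf_{n\to\infty}\frac{s_{\Lambda_n}(\mu'|\mu)}{|\Lambda_n|}$. *)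

theory Defs
  imports "HOL-Probability.Probability"
begin

text \<open>
  The lattice \<open>\<int>\<^sup>d\<close> is \<^typ>\<open>int ^ 'd\<close> with \<open>d = CARD('d) \<ge> 1\<close>. Configurations are functions from the
  lattice to \<open>S\<close>; the topology on this function type is the product topology.
\<close>

type_synonym ('d, 's) config = "(int ^ 'd) \<Rightarrow> 's"

definition prob_on_config :: "('d::finite, 's::polish_space) config measure \<Rightarrow> bool" where
  "prob_on_config \<mu> \<longleftrightarrow>
     prob_space \<mu> \<and> sets \<mu> = sets (Pi\<^sub>M (UNIV :: (int ^ 'd) set) (\<lambda>_. (borel :: 's measure)))"

definition shift :: "int ^ 'd \<Rightarrow> ('d::finite, 's) config \<Rightarrow> ('d, 's) config" where
  "shift i \<sigma> = (\<lambda>j. \<sigma> (j - i))"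

definition translation_invariant :: "('d::finite, 's) config measure \<Rightarrow> bool" where
  "translation_invariant \<mu> \<longleftrightarrow> (\<forall>B\<in>sets \<mu>. \<forall>i. emeasure \<mu> (shift i ` B) = emeasure \<mu> B)"

text \<open>
  \<^const>\<open>ennreal\<close> truncates negative differences to \<open>0\<close>; this does not change the supremum, since
  \<open>\<sigma> = \<eta>\<close> is admissible.
\<close>

definition osc :: "int ^ 'd \<Rightarrow> (('d::finite, 's) config \<Rightarrow> real) \<Rightarrow> ennreal" where
  "osc i f = (SUP (\<sigma>, \<eta>) \<in> {(\<sigma>, \<eta>). \<forall>j. j \<noteq> i \<longrightarrow> \<sigma> j = \<eta> j}. ennreal (f \<sigma> - f \<eta>))"

definition osc_norm2_sq :: "(('d::finite, 's) config \<Rightarrow> real) \<Rightarrow> ennreal" where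
  "osc_norm2_sq f = (\<Sum>\<^sub>\<infinity>i\<in>UNIV. (osc i f)\<^sup>2)"

definition is_local :: "(('d::finite, 's::topological_space) config \<Rightarrow> real) \<Rightarrow> bool" where
  "is_local f \<longleftrightarrow> continuous_on UNIV f \<and> finite {i. osc i f \<noteq> 0}"

definition quasi_local :: "(('d::finite, 's::topological_space) config \<Rightarrow> real) \<Rightarrow> bool" where
  "quasi_local f \<longleftrightarrow>
     continuous_on UNIV f \<and> (\<exists>F. (\<forall>n. is_local (F n)) \<and> uniform_limit UNIV F f sequentially)"

definition measure_separating :: "(('d::finite, 's::polish_space) config \<Rightarrow> real) set \<Rightarrow> bool" where
  "measure_separating \<F> \<longleftrightarrow>
     (\<forall>\<mu> \<mu>'. prob_on_config \<mu> \<longrightarrow> prob_on_config \<mu>' \<longrightarrow> \<mu> \<noteq> \<mu>' \<longrightarrow>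
        (\<exists>f\<in>\<F>. (\<integral>\<sigma>. f \<sigma> \<partial>\<mu>) \<noteq> (\<integral>\<sigma>. f \<sigma> \<partial>\<mu>')))"

text \<open>
  For bounded local \<open>f\<close> the squared norm is a finite sum of finite terms, so \<^const>\<open>enn2real\<close> is
  only a coercion here.
\<close>

definition GCB :: "real \<Rightarrow> ('d::finite, 's::topological_space) config measure \<Rightarrow> bool" where
  "GCB C \<mu> \<longleftrightarrow>
     (\<forall>f. is_local f \<longrightarrow> bounded (range f) \<longrightarrow>
        (\<integral>\<sigma>. exp (f \<sigma> - (\<integral>\<eta>. f \<eta> \<partial>\<mu>)) \<partial>\<mu>) \<le> exp (C / 2 * enn2real (osc_norm2_sq f)))"

definition cylinder_algebra :: "(int ^ 'd) set \<Rightarrow> ('d::finite, 's::topological_space) config measure" where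
  "cylinder_algebra \<Lambda> = sigma UNIV {(\<lambda>\<eta>. \<eta> i) -` A | i A. i \<in> \<Lambda> \<and> A \<in> sets borel}"

definition marginal ::
    "('d::finite, 's::topological_space) config measure \<Rightarrow> (int ^ 'd) set \<Rightarrow> ('d, 's) config measure" where
  "marginal \<mu> \<Lambda> = restr_to_subalg \<mu> (cylinder_algebra \<Lambda>)"

text \<open>
  \<open>rel_entropy \<Lambda> \<mu>' \<mu>\<close> is \<open>s\<^bsub>\<Lambda>\<^esub>(\<mu>' | \<mu>)\<close>; the library functions \<^const>\<open>absolutely_continuous\<close>,
  \<^const>\<open>entropy_density\<close> and \<^const>\<open>KL_divergence\<close> take the reference measure first.
  The Bochner integral in \<^const>\<open>KL_divergence\<close> is \<open>0\<close> for non-integrable functions. Since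
  \<open>- x * ln x \<le> 1\<close>, the negative part of the log-density is always integrable, so
  non-integrability means that the integral is \<open>+\<infinity>\<close> (see \<open>entropy_density_negative_part\<close>).
\<close>

definition rel_entropy ::
    "(int ^ 'd) set \<Rightarrow> ('d::finite, 's::topological_space) config measure \<Rightarrow> ('d, 's) config measure \<Rightarrow> ereal" where
  "rel_entropy \<Lambda> \<mu>' \<mu> =
     (if absolutely_continuous (marginal \<mu> \<Lambda>) (marginal \<mu>' \<Lambda>) \<and>
         integrable (marginal \<mu>' \<Lambda>) (entropy_density (exp 1) (marginal \<mu> \<Lambda>) (marginal \<mu>' \<Lambda>))
      then ereal (KL_divergence (exp 1) (marginal \<mu> \<Lambda>) (marginal \<mu>' \<Lambda>))
      else \<infinity>)"

lemma entropy_density_negative_part: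
  assumes "prob_space M" "prob_space N" "sets N = sets M" "absolutely_continuous M N"
  shows "(\<integral>\<^sup>+ x. ennreal (- entropy_density (exp 1) M N x) \<partial>N) \<le> 1"
proof -
  interpret M: prob_space M by fact
  interpret N: prob_space N by fact
  have fin: "AE x in M. RN_deriv M N x \<noteq> \<infinity>"
    by (intro M.RN_deriv_finite assms(3,4) N.sigma_finite_measure_axioms)
  have dN: "density M (RN_deriv M N) = N"
    by (intro M.density_RN_deriv assms(3,4))
  have "(\<integral>\<^sup>+ x. ennreal (- entropy_density (exp 1) M N x) \<partial>N)
      = (\<integral>\<^sup>+ x. ennreal (- entropy_density (exp 1) M N x) \<partial>density M (RN_deriv M N))"
    by (simp add: dN)
  also have "\<dots> = (\<integral>\<^sup>+ x. RN_deriv M N x * ennreal (- entropy_density (exp 1) M N x) \<partial>M)"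
    by (subst nn_integral_density) auto
  also have "\<dots> \<le> (\<integral>\<^sup>+ x. 1 \<partial>M)"
  proof (rule nn_integral_mono_AE, use fin in eventually_elim)
    fix x assume "RN_deriv M N x \<noteq> \<infinity>"
    then obtain r where r: "RN_deriv M N x = ennreal r" "r \<ge> 0"
      by (cases "RN_deriv M N x") auto
    have "r * - ln r \<le> 1"
    proof (cases "r = 0")
      case False
      then have "- ln r \<le> 1 / r"
        using r(2) ln_le_minus_one[of "1 / r"] by (simp add: ln_div)
      then show ?thesis
        using False r(2) by (simp add: field_simps)
    qed simp
    then show "RN_deriv M N x * ennreal (- entropy_density (exp 1) M N x) \<le> 1"
      using r by (simp add: entropy_density_def log_def flip: ennreal_mult')
  qed
  also have "\<dots> = 1"
    by (simp add: M.emeasure_space_1)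
  finally show ?thesis .
qed

definition lattice_box :: "nat \<Rightarrow> (int ^ 'd::finite) set" where
  "lattice_box n = {i. \<forall>k. - int n \<le> i $ k \<and> i $ k \<le> int n}"

definition lower_rel_entropy_density ::
    "('d::finite, 's::topological_space) config measure \<Rightarrow> ('d, 's) config measure \<Rightarrow> ereal" where
  "lower_rel_entropy_density \<mu>' \<mu> =
     liminf (\<lambda>n. rel_entropy (lattice_box n) \<mu>' \<mu> / ereal (real (card (lattice_box n :: (int ^ 'd) set))))"

end

theory Submission
  imports Defs
begin

text \<open>
  Separation by quasi-local functions yields a bounded local \<open>g\<close> with a strictly larger mean under
  \<open>\<mu>'\<close> than under \<open>\<mu>\<close>. The sum \<open>G\<close> of the translates of \<open>g\<close> over a box depends only on the spins
  of a slightly larger box \<open>\<Lambda>\<close>, its local oscillations are bounded uniformly in the box, and the gap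
  between its two means is of order \<open>card \<Lambda>\<close>. In the Gibbs variational inequality
  \<open>s\<^bsub>\<Lambda>\<^esub>(\<mu>' | \<mu>) \<ge> \<integral> t G d\<mu>' - ln (\<integral> exp (t G) d\<mu>)\<close> the concentration bound makes the loss quadratic
  in \<open>t\<close> and the gain linear in \<open>t\<close>, both proportional to \<open>card \<Lambda>\<close>; a small \<open>t > 0\<close> wins.
\<close>

section \<open>Local oscillations\<close>

lemma osc_le:
  assumes "\<And>\<sigma> \<eta>. (\<And>j. j \<noteq> i \<Longrightarrow> \<sigma> j = \<eta> j) \<Longrightarrow> f \<sigma> - f \<eta> \<le> c"
  shows "osc i f \<le> ennreal c"
  unfolding osc_def by (rule SUP_least) (auto intro!: ennreal_leI assms)

lemma osc_eq_0I:
  assumes "\<And>\<sigma> \<eta>. (\<And>j. j \<noteq> i \<Longrightarrow> \<sigma> j = \<eta> j) \<Longrightarrow> f \<sigma> = f \<eta>"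
  shows "osc i f = 0"
proof -
  have "osc i f \<le> ennreal 0"
    by (rule osc_le) (metis assms diff_self order_refl)
  then show ?thesis by simp
qed

text \<open>Boundedness makes \<open>osc i f\<close> finite; an infinite oscillation would be sent
  to 0 by \<open>enn2real\<close>, and the real-valued bound would be lost.\<close>

lemma diff_le_osc:
  assumes "bounded (range f)" and "\<And>j. j \<noteq> i \<Longrightarrow> \<sigma> j = \<eta> j"
  shows "f \<sigma> - f \<eta> \<le> enn2real (osc i f)"
proof -
  obtain B where B: "\<And>x. \<bar>f x\<bar> \<le> B"
    using assms(1) by (auto simp: bounded_iff)
  have "osc i f \<le> ennreal (2 * B)"
  proof (rule osc_le)
    show "f x - f y \<le> 2 * B" for x y
      using B[of x] B[of y] by linarith
  qed
  then have fin: "osc i f < \<infinity>"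
    by (metis ennreal_less_top infinity_ennreal_def le_less_trans)
  have "ennreal (f \<sigma> - f \<eta>) \<le> osc i f"
    unfolding osc_def using assms(2)
    by (intro SUP_upper2[where i = "(\<sigma>, \<eta>)"]) auto
  then have "enn2real (ennreal (f \<sigma> - f \<eta>)) \<le> enn2real (osc i f)"
    using fin by (intro enn2real_mono) auto
  then show ?thesis
    by (cases "f \<sigma> - f \<eta> \<ge> 0") (auto intro: order_trans[OF _ enn2real_nonneg])
qed

text \<open>The supremum runs over both orders of the pair, so the truncation by
  \<open>ennreal\<close> loses nothing: neither difference can be positive.\<close>

lemma eq_if_osc_eq_0:
  assumes "osc i f = 0" and "\<And>j. j \<noteq> i \<Longrightarrow> \<sigma> j = \<eta> j"
  shows "f \<sigma> = f \<eta>"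
proof -
  have "ennreal (f x - f y) \<le> 0" if "\<And>j. j \<noteq> i \<Longrightarrow> x j = y j" for x y
    using that unfolding assms(1)[symmetric] osc_def
    by (intro SUP_upper2[where i = "(x, y)"]) auto
  from this[of \<sigma> \<eta>] this[of \<eta> \<sigma>] assms(2) show ?thesis
    by (auto simp: ennreal_eq_0_iff)
qed

lemma tendsto_fun_iff:
  fixes g :: "'a \<Rightarrow> 'i \<Rightarrow> 's::topological_space"
  shows "(g \<longlongrightarrow> l) F \<longleftrightarrow> (\<forall>j. ((\<lambda>x. g x j) \<longlongrightarrow> l j) F)"
  using limitin_componentwise[of "\<lambda>_. euclidean" UNIV g l F]
  by (simp add: euclidean_product_topology PiE_UNIV_domain)

text \<open>
  Finitely many coordinates outside the support can be changed one at a time; continuity in the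
  product topology then allows changing all of them.
\<close>

lemma is_local_cong:
  fixes f :: "('d::finite, 's::topological_space) config \<Rightarrow> real"
  assumes "continuous_on UNIV f" and "\<And>i. osc i f \<noteq> 0 \<Longrightarrow> \<sigma> i = \<eta> i"
  shows "f \<sigma> = f \<eta>"
proof -
  \<comment> \<open>\<open>m A\<close> interpolates: it starts at \<open>\<sigma>\<close> for empty
    \<open>A\<close> and tends to \<open>\<eta>\<close> as the finite set \<open>A\<close>
    grows.\<close>
  define m where "m A j = (if j \<in> A then \<eta> j else \<sigma> j)" for A j
  have m: "f (m A) = f \<sigma>" if "finite A" for A
    using that
  proof (induction A rule: finite_induct)
    case empty
    then show ?case by (simp add: m_def[abs_def])
  next
    case (insert i A)
    have "f (m (insert i A)) = f (m A)"
    proof (cases "osc i f = 0")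
      case True
      then show ?thesis
        by (rule eq_if_osc_eq_0) (simp add: m_def)
    next
      case False
      then have "m (insert i A) = m A"
        using assms(2)[of i] by (auto simp: m_def)
      then show ?thesis by simp
    qed
    with insert show ?case by simp
  qed
  \<comment> \<open>Convergence in the product topology is coordinatewise, and coordinate
    \<open>j\<close> is frozen at \<open>\<eta> j\<close> as soon as \<open>A\<close> contains
    \<open>j\<close>.\<close>
  have "(m \<longlongrightarrow> \<eta>) (finite_subsets_at_top UNIV)"
    unfolding tendsto_fun_iff
  proof
    fix j
    have "\<forall>\<^sub>F A in finite_subsets_at_top UNIV. m A j = \<eta> j"
      by (auto simp: eventually_finite_subsets_at_top m_def intro!: exI[of _ "{j}"])
    then show "((\<lambda>A. m A j) \<longlongrightarrow> \<eta> j) (finite_subsets_at_top UNIV)"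
      by (rule tendsto_eventually)
  qed
  then have "((\<lambda>A. f (m A)) \<longlongrightarrow> f \<eta>) (finite_subsets_at_top UNIV)"
    using continuous_on_tendsto_compose[OF assms(1)] by auto
  moreover have "\<forall>\<^sub>F A in finite_subsets_at_top UNIV. f (m A) = f \<sigma>"
    by (auto intro: m)
  then have "((\<lambda>A. f (m A)) \<longlongrightarrow> f \<sigma>) (finite_subsets_at_top UNIV)"
    by (rule tendsto_eventually)
  ultimately show ?thesis
    by (metis tendsto_unique finite_subsets_at_top_neq_bot)
qed

text \<open>With a uniform bound on the oscillations the squared norm grows only linearly in the
  number of sites. This keeps the concentration loss of the same order as the gain.\<close>

lemma osc_norm2_sq_le:
  assumes "finite A" and "\<And>i. i \<notin> A \<Longrightarrow> osc i f = 0" and "\<And>i. osc i f \<le> ennreal c" and "c \<ge> 0"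
  shows "enn2real (osc_norm2_sq f) \<le> real (card A) * c\<^sup>2"
proof -
  have "osc_norm2_sq f = (\<Sum>\<^sub>\<infinity>i\<in>A. (osc i f)\<^sup>2)"
    unfolding osc_norm2_sq_def by (rule infsum_cong_neutral) (auto simp: assms(2))
  also have "\<dots> = (\<Sum>i\<in>A. (osc i f)\<^sup>2)"
    using assms(1) by simp
  also have "\<dots> \<le> (\<Sum>i\<in>A. (ennreal c)\<^sup>2)"
    by (intro sum_mono power_mono assms(3)) auto
  also have "\<dots> = ennreal (real (card A) * c\<^sup>2)"
    using assms(4) by (simp add: ennreal_power ennreal_mult ennreal_of_nat_eq_real_of_nat)
  finally show ?thesis
    using assms(4) by (intro enn2real_leI) auto
qed

section \<open>Lattice boxes\<close>

lemma bij_betw_lattice_box: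
  "bij_betw vec_nth (lattice_box n :: (int ^ 'd::finite) set) (PiE UNIV (\<lambda>_. {- int n..int n}))"
  by (rule bij_betwI[of _ _ _ vec_lambda]) (auto simp: lattice_box_def vec_eq_iff)

lemma finite_lattice_box: "finite (lattice_box n :: (int ^ 'd::finite) set)"
  using bij_betw_finite[OF bij_betw_lattice_box[of n, where 'd='d]] by (simp add: finite_PiE)

lemma card_lattice_box: "card (lattice_box n :: (int ^ 'd::finite) set) = (2 * n + 1) ^ CARD('d)"
proof -
  have "card {- int n..int n} = 2 * n + 1"
    by simp
  then show ?thesis
    using bij_betw_same_card[OF bij_betw_lattice_box[of n, where 'd='d]]
    by (simp add: card_PiE)
qed

text \<open>Per coordinate, 2(n + k) + 1 \<le> (2n + 1)(2k + 1). Enlarging a box by a fixed margin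
  \<open>k\<close> thus costs at most a constant factor in volume, uniformly in
  \<open>n\<close>.\<close>

lemma card_lattice_box_add_le:
  "card (lattice_box (n + k) :: (int ^ 'd::finite) set)
    \<le> card (lattice_box n :: (int ^ 'd) set) * card (lattice_box k :: (int ^ 'd) set)"
  by (simp only: card_lattice_box power_mult_distrib[symmetric]) (rule power_mono, auto simp: algebra_simps)

text \<open>Stated for a difference because \<open>shift i\<close> reads the value at site
  \<open>l\<close> from site \<open>l - i\<close>.\<close>

lemma diff_mem_lattice_box:
  assumes "x \<in> lattice_box n" "y \<in> lattice_box k"
  shows "y - x \<in> lattice_box (n + k)"
  unfolding lattice_box_def
proof safe
  fix l
  have "- int n \<le> x $ l" "x $ l \<le> int n" "- int k \<le> y $ l" "y $ l \<le> int k"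
    using assms by (auto simp: lattice_box_def)
  then show "- int (n + k) \<le> (y - x) $ l" "(y - x) $ l \<le> int (n + k)"
    by auto
qed

lemma finite_subset_lattice_box:
  fixes K :: "(int ^ 'd::finite) set"
  assumes "finite K"
  obtains k where "K \<subseteq> lattice_box k"
proof
  \<comment> \<open>The inserted 0 keeps the maximum meaningful when \<open>K\<close> is
    empty.\<close>
  define k where "k = Max (insert 0 ((\<lambda>(x, l). nat \<bar>x $ l\<bar>) ` (K \<times> UNIV)))"
  have "nat \<bar>x $ l\<bar> \<le> k" if "x \<in> K" for x l
    unfolding k_def using that assms by (intro Max_ge) auto
  then have "\<bar>x $ l\<bar> \<le> int k" if "x \<in> K" for x l
    using that by (simp add: nat_le_iff)
  then show "K \<subseteq> lattice_box k"
    by (auto simp: lattice_box_def abs_le_iff minus_le_iff)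
qed

section \<open>Measurability and translations\<close>

lemma continuous_on_shift: "continuous_on UNIV (shift i :: ('d::finite, 's::topological_space) config \<Rightarrow> _)"
  unfolding shift_def by (intro continuous_on_coordinatewise_then_product continuous_on_product_coordinates)

lemma shift_shift: "shift i (shift j \<sigma>) = shift (i + j) \<sigma>"
  by (simp add: shift_def algebra_simps)

lemma shift_0: "shift 0 \<sigma> = \<sigma>"
  by (simp add: shift_def)

lemma sets_prob_on_config: "prob_on_config \<mu> \<Longrightarrow> sets \<mu> = sets borel"
  by (simp add: prob_on_config_def sets_PiM_equal_borel)

lemma space_prob_on_config: "prob_on_config \<mu> \<Longrightarrow> space \<mu> = UNIV"
  using sets_eq_imp_space_eq[OF sets_prob_on_config] by simp

lemma continuous_imp_measurable:
  assumes "prob_on_config \<mu>" "continuous_on UNIV f"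
  shows "f \<in> \<mu> \<rightarrow>\<^sub>M borel"
  using borel_measurable_continuous_onI[OF assms(2)] sets_prob_on_config[OF assms(1)]
  by (metis measurable_cong_sets)

lemma integrable_bounded_continuous:
  fixes f :: "('d::finite, 's::polish_space) config \<Rightarrow> real"
  assumes "prob_on_config \<mu>" "continuous_on UNIV f" "bounded (range f)"
  shows "integrable \<mu> f"
proof -
  interpret prob_space \<mu>
    using assms(1) by (simp add: prob_on_config_def)
  obtain B where "\<And>x. \<bar>f x\<bar> \<le> B"
    using assms(3) by (auto simp: bounded_iff)
  then show ?thesis
    using continuous_imp_measurable[OF assms(1,2)] by (intro integrable_const_bound[of _ B]) auto
qed

lemma integral_shift:
  fixes f :: "('d::finite, 's::polish_space) config \<Rightarrow> real"
  assumes \<mu>: "prob_on_config \<mu>" "translation_invariant \<mu>" and f: "continuous_on UNIV f"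
  shows "(\<integral>\<sigma>. f (shift i \<sigma>) \<partial>\<mu>) = (\<integral>\<sigma>. f \<sigma> \<partial>\<mu>)"
proof -
  have meas: "shift i \<in> \<mu> \<rightarrow>\<^sub>M \<mu>"
    using continuous_imp_measurable[OF \<mu>(1) continuous_on_shift] sets_prob_on_config[OF \<mu>(1)]
    by (metis measurable_cong_sets)
  have "distr \<mu> \<mu> (shift i) = \<mu>"
  proof (rule measure_eqI)
    fix B assume "B \<in> sets (distr \<mu> \<mu> (shift i))"
    then have B: "B \<in> sets \<mu>" by simp
    \<comment> \<open>Invariance is formulated with images while \<open>distr\<close> uses
      preimages; the inverse translation converts one into the other.\<close>
    have "shift i -` B = shift (- i) ` B"
    proof safe
      fix x assume "shift i x \<in> B"
      moreover have "x = shift (- i) (shift i x)"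
        by (simp add: shift_shift shift_0)
      ultimately show "x \<in> shift (- i) ` B" by blast
    qed (simp add: shift_shift shift_0)
    then show "emeasure (distr \<mu> \<mu> (shift i)) B = emeasure \<mu> B"
      using \<mu>(2) B by (simp add: emeasure_distr[OF meas B] space_prob_on_config[OF \<mu>(1)] translation_invariant_def)
  qed simp
  then show ?thesis
    using integral_distr[OF meas continuous_imp_measurable[OF \<mu>(1) f]] by simp
qed

lemma
  shows space_cylinder_algebra: "space (cylinder_algebra \<Lambda>) = UNIV"
    and sets_cylinder_algebra: "sets (cylinder_algebra \<Lambda>) =
      sigma_sets UNIV {(\<lambda>\<eta>. \<eta> i) -` A | i A. i \<in> \<Lambda> \<and> A \<in> sets borel}"
  by (simp_all add: cylinder_algebra_def space_measure_of_conv)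

lemma measurable_cylinder_coordinate:
  assumes "i \<in> \<Lambda>"
  shows "(\<lambda>\<eta>. \<eta> i) \<in> cylinder_algebra \<Lambda> \<rightarrow>\<^sub>M borel"
  using assms by (intro measurableI) (auto simp: space_cylinder_algebra sets_cylinder_algebra)

lemma subalgebra_cylinder:
  assumes "prob_on_config (\<mu> :: ('d::finite, 's::polish_space) config measure)"
  shows "subalgebra \<mu> (cylinder_algebra \<Lambda>)"
  unfolding subalgebra_def
proof
  show "space (cylinder_algebra \<Lambda>) = space \<mu>"
    by (simp add: space_cylinder_algebra space_prob_on_config[OF assms])
  show "sets (cylinder_algebra \<Lambda>) \<subseteq> sets \<mu>"
    unfolding sets_cylinder_algebra
  proof (rule sets.sigma_sets_subset')
    show "UNIV \<in> sets \<mu>"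
      using sets.top[of \<mu>] by (simp add: space_prob_on_config[OF assms])
    have "(\<lambda>\<eta>. \<eta> i) \<in> \<mu> \<rightarrow>\<^sub>M borel" for i
      by (intro continuous_imp_measurable[OF assms] continuous_on_product_coordinates)
    from measurable_sets[OF this]
    show "{(\<lambda>\<eta>. \<eta> i) -` A | i A. i \<in> \<Lambda> \<and> A \<in> sets borel} \<subseteq> sets \<mu>"
      by (auto simp: space_prob_on_config[OF assms])
  qed
qed

text \<open>Resetting all spins outside \<open>\<Lambda>\<close> to a constant is measurable for the
  cylinder algebra, since each coordinate of the result is either constant or a coordinate in
  \<open>\<Lambda>\<close>. It does not change \<open>f\<close>, so \<open>f\<close> factors through
  this map.\<close>

lemma cylinder_measurable:
  fixes f :: "('d::finite, 's::polish_space) config \<Rightarrow> real"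
  assumes "continuous_on UNIV f" and "\<And>\<sigma> \<eta>. (\<And>i. i \<in> \<Lambda> \<Longrightarrow> \<sigma> i = \<eta> i) \<Longrightarrow> f \<sigma> = f \<eta>"
  shows "f \<in> borel_measurable (cylinder_algebra \<Lambda>)"
proof -
  define p :: "('d, 's) config \<Rightarrow> ('d, 's) config"
    where "p \<sigma> = (\<lambda>i. if i \<in> \<Lambda> then \<sigma> i else undefined)" for \<sigma>
  have "p \<in> cylinder_algebra \<Lambda> \<rightarrow>\<^sub>M Pi\<^sub>M UNIV (\<lambda>_. borel)"
  proof (rule measurable_PiM_single')
    fix i
    show "(\<lambda>\<sigma>. p \<sigma> i) \<in> cylinder_algebra \<Lambda> \<rightarrow>\<^sub>M borel"
      using measurable_cylinder_coordinate[of i \<Lambda>] by (cases "i \<in> \<Lambda>") (auto simp: p_def)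
  qed (auto simp: PiE_UNIV_domain)
  then have "p \<in> cylinder_algebra \<Lambda> \<rightarrow>\<^sub>M borel"
    by (simp cong: measurable_cong_sets add: sets_PiM_equal_borel)
  then have "(\<lambda>\<sigma>. f (p \<sigma>)) \<in> borel_measurable (cylinder_algebra \<Lambda>)"
    using borel_measurable_continuous_onI[OF assms(1)] by measurable
  moreover have "f (p \<sigma>) = f \<sigma>" for \<sigma>
    by (rule assms(2)) (simp add: p_def)
  ultimately show ?thesis by simp
qed

section \<open>Relative entropy\<close>

text \<open>
  The Gibbs variational inequality with a normalised test function: integrate
  \<open>h - ln r \<le> exp h / r - 1\<close> with respect to \<open>N\<close>, where \<open>r\<close> is the density of \<open>N\<close>.
\<close>

lemma KL_divergence_ge:
  fixes h :: "'a \<Rightarrow> real"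
  assumes M: "prob_space M" and N: "prob_space N" and sets: "sets N = sets M"
    and ac: "absolutely_continuous M N"
    and int: "integrable N (entropy_density (exp 1) M N)"
    and h: "h \<in> borel_measurable M" "integrable N h"
    and le1: "(\<integral>\<^sup>+ x. ennreal (exp (h x)) \<partial>M) \<le> 1"
  shows "(\<integral>x. h x \<partial>N) \<le> KL_divergence (exp 1) M N"
proof -
  interpret M: prob_space M by fact
  interpret N: prob_space N by fact
  define r where "r = (\<lambda>x. enn2real (RN_deriv M N x))"
  have [measurable]: "r \<in> borel_measurable M" "h \<in> borel_measurable M"
    unfolding r_def using h by auto
  have [measurable_cong]: "sets N = sets M" by (fact sets)
  have dN: "density M (RN_deriv M N) = N"
    by (intro M.density_RN_deriv ac sets)
  have fin: "AE x in M. RN_deriv M N x \<noteq> \<infinity>"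
    by (intro M.RN_deriv_finite ac sets N.sigma_finite_measure_axioms)
  \<comment> \<open>The set where the density vanishes is null for \<open>N\<close>, so the
    logarithm of \<open>r\<close> is taken at positive arguments only.\<close>
  have pos: "AE x in N. r x > 0"
  proof -
    have "AE x in density M (RN_deriv M N). r x > 0"
      using fin by (subst AE_density) (auto simp: r_def enn2real_positive_iff less_top)
    then show ?thesis by (simp only: dN)
  qed
  have "(\<integral>\<^sup>+ x. ennreal (exp (h x) / r x) \<partial>N)
      = (\<integral>\<^sup>+ x. ennreal (exp (h x) / r x) \<partial>density M (RN_deriv M N))"
    by (simp add: dN)
  also have "\<dots> = (\<integral>\<^sup>+ x. RN_deriv M N x * ennreal (exp (h x) / r x) \<partial>M)"
    by (rule nn_integral_density) measurable
  also have "\<dots> \<le> (\<integral>\<^sup>+ x. ennreal (exp (h x)) \<partial>M)"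
  proof (rule nn_integral_mono_AE, use fin in eventually_elim)
    fix x assume "RN_deriv M N x \<noteq> \<infinity>"
    then have r: "RN_deriv M N x = ennreal (r x)" "r x \<ge> 0"
      by (auto simp: r_def less_top)
    have "RN_deriv M N x * ennreal (exp (h x) / r x) = ennreal (r x * (exp (h x) / r x))"
      by (simp only: r(1) ennreal_mult'[OF r(2)])
    \<comment> \<open>Equality can fail where \<open>r x = 0\<close>: there division gives 0, and
      the left side is 0.\<close>
    also have "\<dots> \<le> ennreal (exp (h x))"
      by (rule ennreal_leI) simp
    finally show "RN_deriv M N x * ennreal (exp (h x) / r x) \<le> ennreal (exp (h x))" .
  qed
  finally have q: "(\<integral>\<^sup>+ x. ennreal (exp (h x) / r x) \<partial>N) \<le> 1"
    using le1 by (rule order_trans)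
  have r0: "r x \<ge> 0" for x
    by (simp add: r_def)
  have qint: "integrable N (\<lambda>x. exp (h x) / r x)"
    using q by (intro integrableI_nonneg) (auto simp: r0 le_less_trans)
  have q1: "(\<integral>x. exp (h x) / r x \<partial>N) \<le> 1"
    using q by (subst integral_eq_nn_integral) (auto simp: r0 intro: enn2real_leI)
  have "(\<integral>x. h x \<partial>N) - KL_divergence (exp 1) M N
      = (\<integral>x. h x - entropy_density (exp 1) M N x \<partial>N)"
    unfolding KL_divergence_def using h int by simp
  also have "\<dots> \<le> (\<integral>x. exp (h x) / r x - 1 \<partial>N)"
  proof (rule integral_mono_AE)
    show "AE x in N. h x - entropy_density (exp 1) M N x \<le> exp (h x) / r x - 1"
      using pos
    proof eventually_elim
      case (elim x)
      have "ln (exp (h x) / r x) \<le> exp (h x) / r x - 1"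
        using elim by (intro ln_le_minus_one) auto
      then show ?case
        using elim by (simp add: ln_div entropy_density_def r_def log_def)
    qed
  qed (use h int qint in auto)
  also have "\<dots> = (\<integral>x. exp (h x) / r x \<partial>N) - 1"
    using qint by (simp add: N.prob_space)
  finally show ?thesis
    using q1 by simp
qed

text \<open>Since \<open>f\<close> is measurable for the cylinder algebra, its integral and that of
  its exponential are the same under a measure and under its marginal, so
  \<open>KL_divergence_ge\<close> applies to the marginals. In the remaining case the entropy is
  infinite.\<close>

lemma rel_entropy_ge:
  fixes f :: "('d::finite, 's::polish_space) config \<Rightarrow> real"
  assumes \<mu>: "prob_on_config \<mu>" and \<mu>': "prob_on_config \<mu>'"
    and f: "continuous_on UNIV f" "bounded (range f)"
    and loc: "\<And>\<sigma> \<eta>. (\<And>i. i \<in> \<Lambda> \<Longrightarrow> \<sigma> i = \<eta> i) \<Longrightarrow> f \<sigma> = f \<eta>"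
    and le1: "(\<integral>\<sigma>. exp (f \<sigma>) \<partial>\<mu>) \<le> 1"
  shows "rel_entropy \<Lambda> \<mu>' \<mu> \<ge> ereal (\<integral>\<sigma>. f \<sigma> \<partial>\<mu>')"
proof (cases "absolutely_continuous (marginal \<mu> \<Lambda>) (marginal \<mu>' \<Lambda>) \<and>
         integrable (marginal \<mu>' \<Lambda>) (entropy_density (exp 1) (marginal \<mu> \<Lambda>) (marginal \<mu>' \<Lambda>))")
  case True
  have ps: "prob_space \<mu>" "prob_space \<mu>'"
    using \<mu> \<mu>' by (auto simp: prob_on_config_def)
  note sub = subalgebra_cylinder[OF \<mu>, of \<Lambda>] and sub' = subalgebra_cylinder[OF \<mu>', of \<Lambda>]
  have meas: "f \<in> borel_measurable (cylinder_algebra \<Lambda>)"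
    using f(1) loc by (rule cylinder_measurable)
  have cont_exp: "continuous_on UNIV (\<lambda>\<sigma>. exp (f \<sigma>))"
    by (intro continuous_intros f)
  obtain B where B: "\<And>x. \<bar>f x\<bar> \<le> B"
    using f(2) by (auto simp: bounded_iff)
  have "f \<sigma> \<le> B" for \<sigma>
    using B[of \<sigma>] by simp
  then have "bounded (range (\<lambda>\<sigma>. exp (f \<sigma>)))"
    by (intro boundedI[of _ "exp B"]) auto
  \<comment> \<open>Integrability ensures that \<open>le1\<close> bounds the true integral and does
    not hold merely through the default value 0.\<close>
  with cont_exp have int_exp: "integrable \<mu> (\<lambda>\<sigma>. exp (f \<sigma>))"
    by (rule integrable_bounded_continuous[OF \<mu>])
  have "(\<integral>\<^sup>+ \<sigma>. ennreal (exp (f \<sigma>)) \<partial>marginal \<mu> \<Lambda>) = (\<integral>\<^sup>+ \<sigma>. ennreal (exp (f \<sigma>)) \<partial>\<mu>)"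
    unfolding marginal_def by (rule nn_integral_subalgebra2[OF sub]) (use meas in measurable)
  also have "\<dots> = ennreal (\<integral>\<sigma>. exp (f \<sigma>) \<partial>\<mu>)"
    by (rule nn_integral_eq_integral[OF int_exp]) simp
  also have "\<dots> \<le> 1"
    using le1 by simp
  finally have nn: "(\<integral>\<^sup>+ \<sigma>. ennreal (exp (f \<sigma>)) \<partial>marginal \<mu> \<Lambda>) \<le> 1" .
  have "(\<integral>\<sigma>. f \<sigma> \<partial>marginal \<mu>' \<Lambda>) \<le> KL_divergence (exp 1) (marginal \<mu> \<Lambda>) (marginal \<mu>' \<Lambda>)"
  proof (rule KL_divergence_ge[OF _ _ _ _ _ _ _ nn])
    show "integrable (marginal \<mu>' \<Lambda>) f"
      unfolding marginal_def using integrable_bounded_continuous[OF \<mu>' f]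
      by (rule integrable_in_subalg[OF sub' meas])
  qed (use True sub sub' ps meas in
      \<open>auto simp: marginal_def sets_restr_to_subalg intro: prob_space_restr_to_subalg measurable_in_subalg\<close>)
  also have "(\<integral>\<sigma>. f \<sigma> \<partial>marginal \<mu>' \<Lambda>) = (\<integral>\<sigma>. f \<sigma> \<partial>\<mu>')"
    unfolding marginal_def by (rule integral_subalgebra2[OF sub' meas])
  finally show ?thesis
    using True by (simp add: rel_entropy_def)
qed (auto simp: rel_entropy_def)

section \<open>Positivity of the entropy density\<close>

text \<open>A local function uniformly within a third of the gap moves each of the two means by at
  most that third, so it still separates. If its means come in the wrong order, its negative is
  taken.\<close>

lemma ex_local_separating:
  fixes \<mu> \<mu>' :: "('d::finite, 's::polish_space) config measure"
  assumes sep: "measure_separating {f :: ('d, 's) config \<Rightarrow> real. quasi_local f \<and> bounded (range f)}"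
    and \<mu>: "prob_on_config \<mu>" and \<mu>': "prob_on_config \<mu>'" and "\<mu>' \<noteq> \<mu>"
  obtains g :: "('d, 's) config \<Rightarrow> real"
  where "is_local g" "bounded (range g)" "(\<integral>\<sigma>. g \<sigma> \<partial>\<mu>) < (\<integral>\<sigma>. g \<sigma> \<partial>\<mu>')"
proof -
  obtain f :: "('d, 's) config \<Rightarrow> real" where f: "quasi_local f" "bounded (range f)"
    and ne: "(\<integral>\<sigma>. f \<sigma> \<partial>\<mu>) \<noteq> (\<integral>\<sigma>. f \<sigma> \<partial>\<mu>')"
    using sep \<mu> \<mu>' \<open>\<mu>' \<noteq> \<mu>\<close> unfolding measure_separating_def by blast
  define e where "e = \<bar>(\<integral>\<sigma>. f \<sigma> \<partial>\<mu>) - (\<integral>\<sigma>. f \<sigma> \<partial>\<mu>')\<bar> / 3"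
  have "e > 0"
    using ne by (simp add: e_def)
  obtain F where F: "\<And>n. is_local (F n)" "uniform_limit UNIV F f sequentially"
    using f(1) unfolding quasi_local_def by blast
  obtain n where n: "\<And>x. \<bar>F n x - f x\<bar> < e"
    using eventually_happens'[OF sequentially_bot uniform_limitD[OF F(2) \<open>e > 0\<close>]]
    by (auto simp: dist_real_def)
  obtain B where B: "\<And>x. \<bar>f x\<bar> \<le> B"
    using f(2) by (auto simp: bounded_iff)
  \<comment> \<open>Locality does not include boundedness; it is inherited from \<open>f\<close>
    through uniform closeness.\<close>
  have bF: "bounded (range (F n))"
  proof (rule boundedI)
    fix y assume "y \<in> range (F n)"
    then obtain x where "y = F n x" by auto
    then show "norm y \<le> B + e"
      using B[of x] n[of x] by simp
  qed
  have cont: "continuous_on UNIV (F n)" "continuous_on UNIV f"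
    using F(1) f(1) by (auto simp: is_local_def quasi_local_def)
  have close: "\<bar>(\<integral>\<sigma>. F n \<sigma> \<partial>\<nu>) - (\<integral>\<sigma>. f \<sigma> \<partial>\<nu>)\<bar> \<le> e" if \<nu>: "prob_on_config \<nu>" for \<nu>
  proof -
    interpret prob_space \<nu>
      using \<nu> by (simp add: prob_on_config_def)
    note int = integrable_bounded_continuous[OF \<nu> cont(1) bF] integrable_bounded_continuous[OF \<nu> cont(2) f(2)]
    have "\<bar>(\<integral>\<sigma>. F n \<sigma> \<partial>\<nu>) - (\<integral>\<sigma>. f \<sigma> \<partial>\<nu>)\<bar> = \<bar>\<integral>\<sigma>. F n \<sigma> - f \<sigma> \<partial>\<nu>\<bar>"
      using int by simp
    also have "\<dots> \<le> (\<integral>\<sigma>. \<bar>F n \<sigma> - f \<sigma>\<bar> \<partial>\<nu>)"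
      by (rule integral_abs_bound)
    also have "\<dots> \<le> (\<integral>\<sigma>. e \<partial>\<nu>)"
      using int n by (intro integral_mono) (auto intro: less_imp_le)
    finally show ?thesis
      by (simp add: prob_space)
  qed
  have ne': "(\<integral>\<sigma>. F n \<sigma> \<partial>\<mu>) \<noteq> (\<integral>\<sigma>. F n \<sigma> \<partial>\<mu>')"
  proof
    assume "(\<integral>\<sigma>. F n \<sigma> \<partial>\<mu>) = (\<integral>\<sigma>. F n \<sigma> \<partial>\<mu>')"
    then have "\<bar>(\<integral>\<sigma>. f \<sigma> \<partial>\<mu>) - (\<integral>\<sigma>. f \<sigma> \<partial>\<mu>')\<bar> \<le> 2 * e"
      using close[OF \<mu>] close[OF \<mu>'] by (simp only: abs_le_iff) argo
    moreover have "\<bar>(\<integral>\<sigma>. f \<sigma> \<partial>\<mu>) - (\<integral>\<sigma>. f \<sigma> \<partial>\<mu>')\<bar> = 3 * e"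
      by (simp add: e_def)
    ultimately show False
      using \<open>e > 0\<close> by simp
  qed
  show thesis
  proof (cases "(\<integral>\<sigma>. F n \<sigma> \<partial>\<mu>) < (\<integral>\<sigma>. F n \<sigma> \<partial>\<mu>')")
    case True
    then show thesis by (rule that[OF F(1) bF])
  next
    case False
    have "osc i (\<lambda>\<sigma>. - F n \<sigma>) = 0" if "osc i (F n) = 0" for i
    proof (rule osc_eq_0I)
      fix \<sigma> \<eta> :: "('d, 's) config" assume "\<And>j. j \<noteq> i \<Longrightarrow> \<sigma> j = \<eta> j"
      then have "F n \<sigma> = F n \<eta>"
        by (rule eq_if_osc_eq_0[OF that])
      then show "- F n \<sigma> = - F n \<eta>" by simp
    qed
    then have "{i. osc i (\<lambda>\<sigma>. - F n \<sigma>) \<noteq> 0} \<subseteq> {i. osc i (F n) \<noteq> 0}"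
      by auto
    then have "is_local (\<lambda>\<sigma>. - F n \<sigma>)"
      using F(1)[of n] unfolding is_local_def
      by (auto intro: continuous_on_minus finite_subset)
    moreover have "bounded (range (\<lambda>\<sigma>. - F n \<sigma>))"
      using bF by (auto simp: bounded_iff)
    ultimately show thesis
    proof (rule that)
      show "(\<integral>\<sigma>. - F n \<sigma> \<partial>\<mu>) < (\<integral>\<sigma>. - F n \<sigma> \<partial>\<mu>')"
        using False ne' by simp
    qed
  qed
qed

text \<open>Changing the spin at \<open>j\<close> changes the translate by \<open>i\<close> only
  through site \<open>j + i\<close> of \<open>g\<close>. These sites are distinct for distinct
  \<open>i\<close>, so the total is at most the sum of all oscillations of \<open>g\<close>,
  whatever the size of \<open>A\<close>.\<close>

lemma osc_sum_shifts:
  fixes g :: "('d::finite, 's::topological_space) config \<Rightarrow> real"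
  assumes g: "is_local g" "bounded (range g)" and A: "finite A" and t: "t \<ge> 0"
  shows "osc j (\<lambda>\<sigma>. t * (\<Sum>i\<in>A. g (shift i \<sigma>)))
    \<le> ennreal (t * (\<Sum>i | osc i g \<noteq> 0. enn2real (osc i g)))"
proof (rule osc_le)
  let ?K = "{i. osc i g \<noteq> 0}"
  fix \<sigma> \<eta> :: "('d, 's) config" assume eq: "\<And>l. l \<noteq> j \<Longrightarrow> \<sigma> l = \<eta> l"
  have fin: "finite ?K"
    using g(1) by (simp add: is_local_def)
  have "(\<Sum>i\<in>A. g (shift i \<sigma>)) - (\<Sum>i\<in>A. g (shift i \<eta>)) = (\<Sum>i\<in>A. g (shift i \<sigma>) - g (shift i \<eta>))"
    by (simp add: sum_subtractf)
  also have "\<dots> \<le> (\<Sum>i\<in>A. enn2real (osc (j + i) g))"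
  proof (intro sum_mono diff_le_osc[OF g(2)])
    fix i l assume "l \<noteq> j + i"
    then show "shift i \<sigma> l = shift i \<eta> l"
      unfolding shift_def by (intro eq) (auto simp: algebra_simps)
  qed
  also have "\<dots> = (\<Sum>i\<in>(+) j ` A. enn2real (osc i g))"
    by (simp add: sum.reindex)
  \<comment> \<open>Restricting to the finite support first makes the bound independent of
    \<open>A\<close>.\<close>
  also have "\<dots> = (\<Sum>i\<in>(+) j ` A \<inter> ?K. enn2real (osc i g))"
    using A by (intro sum.mono_neutral_right) auto
  also have "\<dots> \<le> (\<Sum>i\<in>?K. enn2real (osc i g))"
    using fin by (intro sum_mono2) auto
  finally show "t * (\<Sum>i\<in>A. g (shift i \<sigma>)) - t * (\<Sum>i\<in>A. g (shift i \<eta>))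
      \<le> t * (\<Sum>i\<in>?K. enn2real (osc i g))"
    unfolding right_diff_distrib[symmetric] using t by (rule mult_left_mono)
qed

text \<open>The test function is \<open>t\<close> times the sum of the translates, centred under
  \<open>\<mu>\<close> and lowered by the concentration bound so that its exponential has integral
  at most 1. The gain counts the translates, indexed by the smaller box; the loss counts the sites
  they can see, all in the larger box.\<close>

lemma rel_entropy_box_ge:
  fixes \<mu> \<mu>' :: "('d::finite, 's::polish_space) config measure"
  assumes \<mu>: "prob_on_config \<mu>" "translation_invariant \<mu>" "GCB C \<mu>"
    and \<mu>': "prob_on_config \<mu>'" "translation_invariant \<mu>'"
    and C: "C \<ge> 0" and t: "t \<ge> 0"
    and g: "is_local g" "bounded (range g)" and k: "{i. osc i g \<noteq> 0} \<subseteq> lattice_box k"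
  shows "rel_entropy (lattice_box (n + k)) \<mu>' \<mu>
    \<ge> ereal (t * ((\<integral>\<sigma>. g \<sigma> \<partial>\<mu>') - (\<integral>\<sigma>. g \<sigma> \<partial>\<mu>)) * card (lattice_box n :: (int ^ 'd) set)
        - C / 2 * (card (lattice_box (n + k) :: (int ^ 'd) set) *
            (t * (\<Sum>i | osc i g \<noteq> 0. enn2real (osc i g)))\<^sup>2))"
proof -
  define A where "A = (lattice_box n :: (int ^ 'd) set)"
  define \<Lambda> where "\<Lambda> = (lattice_box (n + k) :: (int ^ 'd) set)"
  define D where "D = (\<Sum>i | osc i g \<noteq> 0. enn2real (osc i g))"
  define G where "G \<sigma> = t * (\<Sum>i\<in>A. g (shift i \<sigma>))" for \<sigma> :: "('d, 's) config"
  \<comment> \<open>An upper bound for the exponent that \<open>GCB\<close> gives for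
    \<open>G\<close>; subtracting it normalises the test function.\<close>
  define c where "c = C / 2 * (card \<Lambda> * (t * D)\<^sup>2)"
  have fin: "finite A" "finite \<Lambda>"
    by (simp_all add: A_def \<Lambda>_def finite_lattice_box)
  have D: "D \<ge> 0"
    by (simp add: D_def sum_nonneg)
  have contg: "continuous_on UNIV g"
    using g(1) by (simp add: is_local_def)
  have conts: "continuous_on UNIV (\<lambda>\<sigma>. g (shift i \<sigma>))" for i
    by (rule continuous_on_compose2[OF contg continuous_on_shift]) auto
  have contG: "continuous_on UNIV G"
    unfolding G_def[abs_def] by (intro continuous_intros conts)
  obtain B where B: "\<And>x. \<bar>g x\<bar> \<le> B"
    using g(2) by (auto simp: bounded_iff)
  have bndG: "bounded (range G)"
  proof (rule boundedI)
    fix y assume "y \<in> range G"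
    then obtain \<sigma> where y: "y = G \<sigma>" by auto
    have "\<bar>\<Sum>i\<in>A. g (shift i \<sigma>)\<bar> \<le> (\<Sum>i\<in>A. B)"
      by (rule order_trans[OF sum_abs]) (intro sum_mono B)
    then show "norm y \<le> t * (\<Sum>i\<in>A. B)"
      unfolding y G_def using t by (simp only: real_norm_def abs_mult abs_of_nonneg mult_left_mono)
  qed
  have localG: "G \<sigma> = G \<eta>" if eq: "\<And>j. j \<in> \<Lambda> \<Longrightarrow> \<sigma> j = \<eta> j" for \<sigma> \<eta>
  proof -
    have "g (shift i \<sigma>) = g (shift i \<eta>)" if "i \<in> A" for i
    proof (rule is_local_cong[OF contg])
      fix l assume "osc l g \<noteq> 0"
      then have "l - i \<in> \<Lambda>"
        using k \<open>i \<in> A\<close> unfolding A_def \<Lambda>_def by (intro diff_mem_lattice_box) auto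
      then show "shift i \<sigma> l = shift i \<eta> l"
        by (simp add: shift_def eq)
    qed
    then show ?thesis
      by (simp add: G_def)
  qed
  have osc0: "osc j G = 0" if "j \<notin> \<Lambda>" for j
  proof (rule osc_eq_0I)
    fix \<sigma> \<eta> :: "('d, 's) config" assume eq: "\<And>l. l \<noteq> j \<Longrightarrow> \<sigma> l = \<eta> l"
    show "G \<sigma> = G \<eta>"
    proof (rule localG)
      fix l assume "l \<in> \<Lambda>"
      with that have "l \<noteq> j" by auto
      then show "\<sigma> l = \<eta> l" by (rule eq)
    qed
  qed
  have "is_local G"
    unfolding is_local_def
    using contG finite_subset[OF _ fin(2), of "{i. osc i G \<noteq> 0}"] osc0 by blast
  then have "(\<integral>\<sigma>. exp (G \<sigma> - (\<integral>\<eta>. G \<eta> \<partial>\<mu>)) \<partial>\<mu>) \<le> exp (C / 2 * enn2real (osc_norm2_sq G))"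
    using \<mu>(3) bndG unfolding GCB_def by blast
  also have "enn2real (osc_norm2_sq G) \<le> card \<Lambda> * (t * D)\<^sup>2"
    using fin(2) osc0
  proof (rule osc_norm2_sq_le)
    show "osc i G \<le> ennreal (t * D)" for i
      unfolding G_def[abs_def] D_def by (rule osc_sum_shifts[OF g fin(1) t])
  qed (use t D in auto)
  then have "exp (C / 2 * enn2real (osc_norm2_sq G)) \<le> exp c"
    unfolding c_def using C by (simp add: mult_left_mono)
  finally have gcb: "(\<integral>\<sigma>. exp (G \<sigma> - (\<integral>\<eta>. G \<eta> \<partial>\<mu>)) \<partial>\<mu>) \<le> exp c" .
  \<comment> \<open>By translation invariance all translates have the same mean, so the mean of the
    sum is proportional to the number of translates.\<close>
  have intG: "(\<integral>\<sigma>. G \<sigma> \<partial>\<nu>) = t * (card A * (\<integral>\<sigma>. g \<sigma> \<partial>\<nu>))"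
    if "prob_on_config \<nu>" "translation_invariant \<nu>" for \<nu>
  proof -
    have "integrable \<nu> (\<lambda>\<sigma>. g (shift i \<sigma>))" for i
      by (rule integrable_bounded_continuous[OF that(1) conts])
        (use B in \<open>auto simp: bounded_iff\<close>)
    then show ?thesis
      unfolding G_def by (simp add: integral_shift[OF that contg])
  qed
  let ?h = "\<lambda>\<sigma>. G \<sigma> - (\<integral>\<eta>. G \<eta> \<partial>\<mu>) - c"
  have "rel_entropy \<Lambda> \<mu>' \<mu> \<ge> ereal (\<integral>\<sigma>. ?h \<sigma> \<partial>\<mu>')"
  proof (rule rel_entropy_ge[OF \<mu>(1) \<mu>'(1)])
    show "continuous_on UNIV ?h"
      by (intro continuous_intros contG)
    have "bounded ((\<lambda>y. y - ((\<integral>\<eta>. G \<eta> \<partial>\<mu>) + c)) ` range G)"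
      by (rule bounded_translation_minus[OF bndG])
    then show "bounded (range ?h)"
      by (simp add: image_image algebra_simps)
    show "?h \<sigma> = ?h \<eta>" if "\<And>i. i \<in> \<Lambda> \<Longrightarrow> \<sigma> i = \<eta> i" for \<sigma> \<eta>
      using localG[OF that] by simp
    have "(\<integral>\<sigma>. exp (?h \<sigma>) \<partial>\<mu>) = (\<integral>\<sigma>. exp (G \<sigma> - (\<integral>\<eta>. G \<eta> \<partial>\<mu>)) \<partial>\<mu>) / exp c"
      by (simp add: exp_diff)
    also have "\<dots> \<le> 1"
      using gcb by simp
    finally show "(\<integral>\<sigma>. exp (?h \<sigma>) \<partial>\<mu>) \<le> 1" .
  qed
  also have "(\<integral>\<sigma>. ?h \<sigma> \<partial>\<mu>') = (\<integral>\<sigma>. G \<sigma> \<partial>\<mu>') - (\<integral>\<sigma>. G \<sigma> \<partial>\<mu>) - c"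
  proof -
    interpret prob_space \<mu>'
      using \<mu>'(1) by (simp add: prob_on_config_def)
    show ?thesis
      using integrable_bounded_continuous[OF \<mu>'(1) contG bndG] by (simp add: prob_space)
  qed
  also have "\<dots> = t * ((\<integral>\<sigma>. g \<sigma> \<partial>\<mu>') - (\<integral>\<sigma>. g \<sigma> \<partial>\<mu>)) * card A - c"
    by (simp add: intG[OF \<mu>(1,2)] intG[OF \<mu>'] algebra_simps)
  finally show ?thesis
    by (simp only: A_def \<Lambda>_def D_def c_def)
qed

theorem theorem3p1:
  fixes C :: real
    and \<mu> \<mu>' :: "('d::finite, 's::polish_space) config measure"
  assumes "bounded (UNIV :: 's set)"
    and "measure_separating {f :: ('d, 's) config \<Rightarrow> real. quasi_local f \<and> bounded (range f)}"
    and "C > 0"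
    and "prob_on_config \<mu>" and "translation_invariant \<mu>" and "GCB C \<mu>"
    and "prob_on_config \<mu>'" and "translation_invariant \<mu>'"
    and "\<mu>' \<noteq> \<mu>"
  shows "lower_rel_entropy_density \<mu>' \<mu> > 0"
proof -
  obtain g :: "('d, 's) config \<Rightarrow> real" where g: "is_local g" "bounded (range g)"
    and less: "(\<integral>\<sigma>. g \<sigma> \<partial>\<mu>) < (\<integral>\<sigma>. g \<sigma> \<partial>\<mu>')"
    using ex_local_separating[OF assms(2,4,7,9)] by blast
  obtain k where k: "{i. osc i g \<noteq> 0} \<subseteq> lattice_box k"
    using g(1) unfolding is_local_def by (blast intro: finite_subset_lattice_box)
  define e where "e = (\<integral>\<sigma>. g \<sigma> \<partial>\<mu>') - (\<integral>\<sigma>. g \<sigma> \<partial>\<mu>)"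
  define D where "D = (\<Sum>i | osc i g \<noteq> 0. enn2real (osc i g))"
  define b where "b = real (card (lattice_box k :: (int ^ 'd) set))"
  \<comment> \<open>A lower bound for the gap per site of the larger box, since the larger box has
    at most \<open>b\<close> times as many sites as the smaller one.\<close>
  define a where "a = e / b"
  text \<open>The maximiser of \<open>t a - C t\<^sup>2 (D\<^sup>2 + 1) / 2\<close>; the added \<open>1\<close> avoids division by zero.\<close>
  define t where "t = a / (C * (D\<^sup>2 + 1))"
  \<comment> \<open>The maximum value of that quadratic: at its maximiser the loss is half of the
    linear gain \<open>t * a\<close>.\<close>
  define \<delta> where "\<delta> = t * a / 2"
  have "b > 0"
    by (simp add: b_def card_lattice_box)
  have D2: "D\<^sup>2 + 1 > 0"
    by (intro add_nonneg_pos) auto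
  have "a > 0"
    using less \<open>b > 0\<close> by (simp add: a_def e_def)
  then have "t > 0" "\<delta> > 0"
    using D2 \<open>C > 0\<close> by (simp_all add: t_def \<delta>_def)
  have \<delta>: "\<delta> \<le> t * a - C / 2 * (t * D)\<^sup>2"
  proof -
    have "t * (C * (D\<^sup>2 + 1)) = a"
      using D2 \<open>C > 0\<close> by (simp add: t_def)
    moreover have "C / 2 * (t\<^sup>2 * (D\<^sup>2 + 1)) = t * (t * (C * (D\<^sup>2 + 1))) / 2"
      by (simp add: power2_eq_square)
    ultimately have "\<delta> = t * a - C / 2 * (t\<^sup>2 * (D\<^sup>2 + 1))"
      by (simp add: \<delta>_def)
    moreover have "C / 2 * (t * D)\<^sup>2 \<le> C / 2 * (t\<^sup>2 * (D\<^sup>2 + 1))"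
      unfolding power_mult_distrib using \<open>C > 0\<close> by (intro mult_left_mono) simp_all
    ultimately show ?thesis by linarith
  qed
  \<comment> \<open>Boxes with \<open>N \<ge> k\<close> have room for the margin: the translates are
    indexed by \<open>lattice_box (N - k)\<close>. The finitely many smaller boxes do not affect the
    liminf.\<close>
  have ge: "ereal \<delta> \<le> rel_entropy (lattice_box N) \<mu>' \<mu> / ereal (real (card (lattice_box N :: (int ^ 'd) set)))"
    if N: "N \<ge> k" for N
  proof -
    obtain n where n: "N = n + k"
      using N by (metis le_add_diff_inverse2)
    let ?L = "real (card (lattice_box N :: (int ^ 'd) set))"
    let ?A = "real (card (lattice_box n :: (int ^ 'd) set))"
    have L: "?L > 0"
      by (simp add: card_lattice_box)
    have "?L \<le> ?A * b"
      using card_lattice_box_add_le[of n k, where 'd='d]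
      unfolding n b_def by (simp only: of_nat_mult[symmetric] of_nat_le_iff)
    then have "a * ?L \<le> e * ?A"
      using \<open>a > 0\<close> \<open>b > 0\<close> mult_left_mono[of ?L "?A * b" a] by (simp add: a_def)
    then have "t * (a * ?L) \<le> t * (e * ?A)"
      using \<open>t > 0\<close> by simp
    moreover have "\<delta> * ?L \<le> (t * a - C / 2 * (t * D)\<^sup>2) * ?L"
      using \<delta> L by (intro mult_right_mono) auto
    ultimately have "\<delta> * ?L \<le> t * e * ?A - C / 2 * (?L * (t * D)\<^sup>2)"
      by (simp add: algebra_simps)
    then have "ereal (\<delta> * ?L) \<le> ereal (t * e * ?A - C / 2 * (?L * (t * D)\<^sup>2))"
      by simp
    also have "\<dots> \<le> rel_entropy (lattice_box N) \<mu>' \<mu>"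
      using rel_entropy_box_ge[OF assms(4,5,6,7,8) _ _ g k, of t n] \<open>C > 0\<close> \<open>t > 0\<close>
      unfolding n e_def D_def by simp
    finally show ?thesis
      using L by (simp add: ereal_le_divide_pos mult.commute)
  qed
  have "ereal \<delta> \<le> lower_rel_entropy_density \<mu>' \<mu>"
    unfolding lower_rel_entropy_density_def
    by (rule Liminf_bounded) (use ge in \<open>auto simp: eventually_sequentially\<close>)
  then show ?thesis
    using \<open>\<delta> > 0\<close> by (metis ereal_less(2) less_le_trans)
qed

end
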